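(* Let $q\ge 3$ be an integer, let $2=p_1<p_2<\cdots<p_m\le q-1$ be the list of all primes smaller than $q$, and put $\alpha_i=\log_q p_i$ for $i=1,\dots,m$. Let $k\ge 1$ and let $1\le i_1<i_2<\cdots<i_k\le m$ be chosen so that the real numbers $1,\alpha_{i_1},\alpha_{i_2},\dots,\alpha_{i_k}$ are rationally independent (i.e. linearly independent over $\mathbb{Q}$). Then for every positive divisor $d$ of $q$, the set $$A=\left\{(n_1,n_2,\dots,n_k)\in \mathbb{Z}_+^k:\ S_q\!\left(p_{i_1}^{n_1}p_{i_2}^{n_2}\cdots p_{i_k}^{n_k}\cdot d\right)=0\right\}$$ has asymptotic density equal to $1$.
   Context: $\mathbb{Z}_+=\{0,1,2,\dots\}$. For an integer base $q>1$ and a non-negative integer $n$ with base-$q$ expansion $n=\sum_{j=1}^k d_jq^{k-j}$, $d_j\in\{0,\dots,q-1\}$ (with $d_1\ne 0$ when $n\ge 1$), the Sloane map is $S_q(n)=\prod_{j=1}^k d_j$, the product of the base-$q$ digits of $n$. For $N\ge 1$ let $\Lambda_N^+=\{\boldsymbol{n}\in\mathbb{Z}_+^k: n_i\le N,\ i=1,\dots,k\}$. For $A\subseteq \mathbb{Z}_+^k$ the lower and upper asymptotic densities are $D^-(A)=\liminf_{N\to\infty}\frac{1}{N^k}\#(A\cap\Lambda_N^+)$ and $D^+(A)=\limsup_{N\to\infty}\frac{1}{N^k}\#(A\cap\Lambda_N^+)$. If $D^-(A)=D^+(A)$, the common value $D(A)$ is called the asymptotic density of $A$. *)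

theory Defs
  imports "HOL-Analysis.Analysis" "HOL-Computational_Algebra.Primes"
begin

text \<open>
  The base-\<open>q\<close> digits, most significant digit first. The number \<open>0\<close> has the single digit \<open>0\<close>.
  The test \<open>q \<le> 1\<close> only serves termination.
\<close>

function base_digits :: "nat \<Rightarrow> nat \<Rightarrow> nat list" where
  "base_digits q n =
     (if q \<le> 1 \<or> n < q then [n] else base_digits q (n div q) @ [n mod q])"
  by pat_completeness auto
termination
  by (relation "Wellfounded.measure snd") auto

declare base_digits.simps [simp del]

definition sloane :: "nat \<Rightarrow> nat \<Rightarrow> nat" where
  "sloane q n = prod_list (base_digits q n)"

lemma base_digits_not_Nil: "base_digits q n \<noteq> []"
  by (subst base_digits.simps) auto

lemma base_digits_less:
  assumes "q > 1" "x \<in> set (base_digits q n)"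
  shows "x < q"
  using assms
proof (induction q n rule: base_digits.induct)
  case (1 q n)
  show ?case
    using 1 base_digits.simps[of q n] by (cases "n < q") auto
qed

lemma hd_base_digits_nonzero:
  assumes "q > 1" "n \<ge> 1"
  shows "hd (base_digits q n) \<noteq> 0"
  using assms
proof (induction q n rule: base_digits.induct)
  case (1 q n)
  show ?case
  proof (cases "n < q")
    case True
    then show ?thesis using 1 by (subst base_digits.simps) auto
  next
    case False
    then have "n div q \<ge> 1"
      using 1 by (simp add: Suc_le_eq div_greater_zero_iff)
    then have "hd (base_digits q (n div q)) \<noteq> 0"
      using 1 False by auto
    then show ?thesis
      using 1 False by (subst base_digits.simps) (auto simp: base_digits_not_Nil)
  qed
qed

lemma base_digits_expansion:
  assumes "q > 1"
  shows "(\<Sum>j<length (base_digits q n).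
            base_digits q n ! j * q ^ (length (base_digits q n) - Suc j)) = n"
  using assms
proof (induction q n rule: base_digits.induct)
  case (1 q n)
  show ?case
  proof (cases "n < q")
    case True
    then have "base_digits q n = [n]" by (subst base_digits.simps) auto
    then show ?thesis by simp
  next
    case False
    let ?ds = "base_digits q (n div q)"
    have ds: "base_digits q n = ?ds @ [n mod q]"
      using 1 False by (subst base_digits.simps) auto
    have "(\<Sum>j<length ?ds. ?ds ! j * q ^ (length ?ds - j)) =
          q * (\<Sum>j<length ?ds. ?ds ! j * q ^ (length ?ds - Suc j))"
      by (auto simp: sum_distrib_left Suc_diff_Suc simp flip: power_Suc intro!: sum.cong)
    also have "\<dots> = q * (n div q)"
      using 1 False by auto
    finally show ?thesis
      by (simp add: ds nth_append)
  qed
qed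


text \<open>The real numbers as a vector space over \<open>\<rat>\<close>.\<close>

interpretation rat_real: vector_space "\<lambda>(r::rat) (x::real). of_rat r * x"
  by unfold_locales (auto simp: algebra_simps of_rat_add of_rat_mult)

text \<open>
  Linear independence over \<open>\<rat>\<close> of a finite family, given as a list. As the library notion is
  about sets, repeated entries have to be excluded explicitly.
\<close>

definition rationally_independent :: "real list \<Rightarrow> bool" where
  "rationally_independent xs \<longleftrightarrow> distinct xs \<and> rat_real.independent (set xs)"


text \<open>
  Elements of \<open>\<int>\<^sub>+\<^sup>k\<close> are extensional functions on \<open>{1..k}\<close> (value \<open>undefined\<close> elsewhere), so that
  each tuple is represented exactly once and cardinalities are the intended ones.
\<close>

definition nat_tuples :: "nat \<Rightarrow> (nat \<Rightarrow> nat) set" where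
  "nat_tuples k = ({1..k} \<rightarrow>\<^sub>E UNIV)"

definition tuple_box :: "nat \<Rightarrow> nat \<Rightarrow> (nat \<Rightarrow> nat) set" where
  "tuple_box k N = {n \<in> nat_tuples k. \<forall>j\<in>{1..k}. n j \<le> N}"

definition lower_density :: "nat \<Rightarrow> (nat \<Rightarrow> nat) set \<Rightarrow> ereal" where
  "lower_density k A = liminf (\<lambda>N. ereal (real (card (A \<inter> tuple_box k N)) / real N ^ k))"

definition upper_density :: "nat \<Rightarrow> (nat \<Rightarrow> nat) set \<Rightarrow> ereal" where
  "upper_density k A = limsup (\<lambda>N. ereal (real (card (A \<inter> tuple_box k N)) / real N ^ k))"

definition has_asymptotic_density :: "nat \<Rightarrow> (nat \<Rightarrow> nat) set \<Rightarrow> real \<Rightarrow> bool" where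
  "has_asymptotic_density k A D \<longleftrightarrow>
     lower_density k A = ereal D \<and> upper_density k A = ereal D"

lemma finite_tuple_box: "finite (tuple_box k N)"
proof -
  have "tuple_box k N \<subseteq> {1..k} \<rightarrow>\<^sub>E {..N}"
    by (auto simp: tuple_box_def nat_tuples_def PiE_def)
  then show ?thesis by (rule finite_subset) (auto intro: finite_PiE)
qed

end

theory Submission
  imports Defs
begin

text \<open>
  The exceptional tuples are those for which the product has no zero digit, and one coordinate
  already forces them to be rare. Freeze all coordinates except the first; what remains is a
  sequence \<open>b ^ n * C\<close> with \<open>\<alpha> = log q b\<close> irrational, and it suffices to bound the number of
  \<open>n \<le> N\<close> with \<open>sloane q (b ^ n * C) \<noteq> 0\<close> by \<open>\<epsilon> * (N + 1)\<close> for all large \<open>N\<close>, uniformly in \<open>C\<close>.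

  Only leading digits matter for this. There are at most \<open>(q - 1) ^ (l + 2)\<close> zero-free words \<open>w\<close>
  of \<open>l + 2\<close> digits. If \<open>b ^ n * C\<close> and \<open>b ^ n' * C\<close> both begin with \<open>w\<close>, then \<open>(n - n') * \<alpha>\<close> is
  within \<open>1 / (2 * q ^ l)\<close> of an integer. Instead of invoking equidistribution, such \<open>n\<close> are
  counted by packing: by density of the multiples of \<open>\<alpha>\<close> modulo \<open>1\<close> there are \<open>q ^ l\<close> shifts
  \<open>s\<close> for which the points \<open>s * \<alpha>\<close> are \<open>1 / (2 * q ^ l)\<close>-separated on the circle, and the
  corresponding translates of the set of these \<open>n\<close> are pairwise disjoint
  (\<open>packing_close_multiples\<close>). So each \<open>w\<close> takes at most a share of about \<open>1 / q ^ l\<close> of all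
  \<open>n\<close>, and all words together at most \<open>(q - 1)\<^sup>2 * ((q - 1) / q) ^ l\<close>, which tends to \<open>0\<close> as
  \<open>l\<close> grows. The shifts depend on \<open>\<alpha>\<close> and \<open>l\<close> only, whence the uniformity in \<open>C\<close>.
\<close>

section \<open>Packing translates of sets of close multiples\<close>

text \<open>
  Each of the points \<open>i / M\<close> on the circle is approximated by a multiple of \<open>\<alpha>\<close> with error below
  \<open>1 / (4 * M)\<close>, so at least half of the gap \<open>1 / M\<close> between any two of them survives.
\<close>

lemma separated_multiples:
  fixes \<alpha> :: real and M :: nat
  assumes "\<alpha> \<notin> \<rat>" "M > 0"
  obtains s :: "nat \<Rightarrow> nat" where
    "\<And>i j z::int. i < M \<Longrightarrow> j < M \<Longrightarrow> i \<noteq> j \<Longrightarrow>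
        \<bar>(real (s i) - real (s j)) * \<alpha> - of_int z\<bar> \<ge> 1 / (2 * real M)"
proof -
  have "\<exists>k. \<bar>frac (real k * \<alpha>) - real i / real M\<bar> < 1 / (4 * real M)" if "i < M" for i
    by (rule Kronecker_approx_1_explicit[OF assms(1), of "real i / real M" "1 / (4 * real M)"])
       (use that assms in auto)
  then obtain s where s: "\<And>i. i < M \<Longrightarrow>
      \<bar>frac (real (s i) * \<alpha>) - real i / real M\<bar> < 1 / (4 * real M)"
    by metis
  have sep: "\<bar>(real (s i) - real (s j)) * \<alpha> - of_int z\<bar> \<ge> 1 / (2 * real M)"
    if ij: "i < M" "j < M" "i \<noteq> j" for i j and z :: int
  proof -
    define h where "h = 1 / (4 * real M)"
    have h: "h > 0" "real M * h = 1 / 4"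
      using assms by (auto simp: h_def)
    have idx: "real a / real M = 4 * h * real a" for a
      by (simp add: h_def)
    define t where "t = z - \<lfloor>real (s i) * \<alpha>\<rfloor> + \<lfloor>real (s j) * \<alpha>\<rfloor>"
    define D where "D = frac (real (s i) * \<alpha>) - frac (real (s j) * \<alpha>)"
    have eq: "(real (s i) - real (s j)) * \<alpha> - of_int z = D - of_int t"
      by (simp add: D_def t_def frac_def algebra_simps)
    have "\<bar>D - 4 * h * (real i - real j)\<bar> < 2 * h"
      using s[OF ij(1)] s[OF ij(2)] unfolding D_def idx h_def[symmetric]
      by (simp add: algebra_simps)
    moreover have "4 * h * \<bar>real i - real j\<bar> \<ge> 4 * h * 1"
      using ij h by (intro mult_left_mono) auto
    moreover have "4 * h * \<bar>real i - real j\<bar> \<le> 4 * h * (real M - 1)"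
      using ij h by (intro mult_left_mono) auto
    moreover have "4 * h * (real M - 1) = 1 - 4 * h"
      using h by (simp add: algebra_simps)
    moreover have "\<bar>4 * h * (real i - real j)\<bar> = 4 * h * \<bar>real i - real j\<bar>"
      using h by (simp add: abs_mult)
    ultimately have "\<bar>D\<bar> \<ge> 2 * h" "\<bar>D\<bar> \<le> 1 - 2 * h"
      by linarith+
    moreover have "t = 0 \<or> of_int \<bar>t\<bar> \<ge> (1::real)"
      by linarith
    ultimately have "\<bar>D - of_int t\<bar> \<ge> 2 * h"
      by (auto simp flip: of_int_abs)
    then show ?thesis
      unfolding eq by (simp add: h_def)
  qed
  show ?thesis using that[OF sep] .
qed

text \<open>
  If \<open>n + s = n' + s'\<close> for two of the separated shifts, then \<open>(n - n') * \<alpha>\<close> is at once close to an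
  integer and far from it. Hence the \<open>M\<close> translates of \<open>E\<close> are disjoint and must all fit into
  \<open>{..N + S}\<close>, where \<open>S\<close> bounds the shifts.
\<close>

lemma packing_close_multiples:
  fixes \<alpha> :: real and M :: nat
  assumes "\<alpha> \<notin> \<rat>" "M > 0"
  shows "\<exists>S. \<forall>N. \<forall>E\<subseteq>{..N}.
       (\<forall>n\<in>E. \<forall>n'\<in>E. \<exists>z::int. \<bar>(real n - real n') * \<alpha> - of_int z\<bar> < 1 / (2 * real M)) \<longrightarrow>
       M * card E \<le> N + 1 + S"
proof -
  obtain s :: "nat \<Rightarrow> nat" where s: "\<And>i j z::int. i < M \<Longrightarrow> j < M \<Longrightarrow> i \<noteq> j \<Longrightarrow>
        \<bar>(real (s i) - real (s j)) * \<alpha> - of_int z\<bar> \<ge> 1 / (2 * real M)"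
    using separated_multiples[OF assms] by metis
  define S where "S = (\<Sum>i<M. s i)"
  have sS: "s i \<le> S" if "i < M" for i
    unfolding S_def using that by (intro member_le_sum) auto
  have bound: "M * card E \<le> N + 1 + S"
    if E: "E \<subseteq> {..N}"
      and close: "\<forall>n\<in>E. \<forall>n'\<in>E. \<exists>z::int.
        \<bar>(real n - real n') * \<alpha> - of_int z\<bar> < 1 / (2 * real M)" for N E
  proof -
    have "inj_on (\<lambda>(i, n). n + s i) ({..<M} \<times> E)"
    proof (rule inj_onI, clarsimp)
      fix i n i' n'
      assume *: "i < M" "n \<in> E" "i' < M" "n' \<in> E" "n + s i = n' + s i'"
      have "i = i'"
      proof (rule ccontr)
        assume "i \<noteq> i'"
        obtain z :: int where "\<bar>(real n - real n') * \<alpha> - of_int z\<bar> < 1 / (2 * real M)"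
          using close * by blast
        moreover have "real n - real n' = real (s i') - real (s i)"
          using *(5) by linarith
        ultimately have "\<bar>(real (s i') - real (s i)) * \<alpha> - of_int z\<bar> < 1 / (2 * real M)"
          by metis
        moreover have "\<bar>(real (s i') - real (s i)) * \<alpha> - of_int z\<bar> \<ge> 1 / (2 * real M)"
          using * \<open>i \<noteq> i'\<close> by (intro s) auto
        ultimately show False by linarith
      qed
      then show "i = i' \<and> n = n'" using * by simp
    qed
    then have "M * card E = card ((\<lambda>(i, n). n + s i) ` ({..<M} \<times> E))"
      by (simp only: card_image card_cartesian_product card_lessThan)
    also have "\<dots> \<le> card {..N + S}"
      using E sS by (intro card_mono) (auto intro!: add_mono)
    finally show ?thesis by simp
  qed
  then show ?thesis by (intro exI[of _ S]) simp
qed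

section \<open>Zero-free leading digits\<close>

lemma sloane_step:
  assumes "q > 1" "n \<ge> q"
  shows "sloane q n = sloane q (n div q) * (n mod q)"
  using assms unfolding sloane_def by (subst base_digits.simps) auto

text \<open>
  The bounds on \<open>w\<close> say that it has \<open>j + 1\<close> digits.
\<close>

definition zero_free_words :: "nat \<Rightarrow> nat \<Rightarrow> nat set" where
  "zero_free_words q j = {w. q ^ j \<le> w \<and> w < q ^ Suc j \<and> sloane q w \<noteq> 0}"

lemma finite_zero_free_words: "finite (zero_free_words q j)"
  by (rule finite_subset[of _ "{..<q ^ Suc j}"]) (auto simp: zero_free_words_def)

lemma zero_free_words_Suc:
  assumes "q > 1" "w \<in> zero_free_words q (Suc j)"
  shows "w div q \<in> zero_free_words q j" "w mod q \<in> {1..<q}"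
proof -
  have w: "q ^ Suc j \<le> w" "w < q ^ Suc j * q" "sloane q w \<noteq> 0"
    using assms by (auto simp: zero_free_words_def mult_ac)
  have "q \<le> q ^ Suc j"
    using assms by simp
  then have "sloane q w = sloane q (w div q) * (w mod q)"
    using w assms by (intro sloane_step) linarith+
  moreover have "q ^ j \<le> w div q"
    using w assms by (simp add: less_eq_div_iff_mult_less_eq mult_ac)
  moreover have "w div q < q ^ Suc j"
    using w assms by (subst div_less_iff_less_mult) auto
  ultimately show "w div q \<in> zero_free_words q j" "w mod q \<in> {1..<q}"
    using w assms by (auto simp: zero_free_words_def)
qed

lemma card_zero_free_words:
  assumes "q > 1"
  shows "card (zero_free_words q j) \<le> (q - 1) ^ Suc j"
proof (induction j)
  case 0
  have "sloane q 0 = 0"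
    using assms unfolding sloane_def by (subst base_digits.simps) auto
  then have "zero_free_words q 0 \<subseteq> {1..<q}"
    by (auto simp: zero_free_words_def)
  from card_mono[OF _ this] show ?case by simp
next
  case (Suc j)
  have "inj_on (\<lambda>w. (w div q, w mod q)) (zero_free_words q (Suc j))"
    by (rule inj_onI) (metis div_mult_mod_eq prod.inject)
  moreover have "(\<lambda>w. (w div q, w mod q)) ` zero_free_words q (Suc j)
      \<subseteq> zero_free_words q j \<times> {1..<q}"
    using zero_free_words_Suc[OF assms] by auto
  ultimately have "card (zero_free_words q (Suc j)) \<le> card (zero_free_words q j \<times> {1..<q})"
    by (intro card_inj_on_le) (auto simp: finite_zero_free_words)
  also have "\<dots> \<le> (q - 1) ^ Suc j * (q - 1)"
    using Suc by (simp add: card_cartesian_product)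
  finally show ?case by (simp add: mult_ac)
qed

text \<open>
  Dropping the last digit creates no zero, so it can be repeated until \<open>j + 1\<close> digits are left; \<open>e\<close>
  is the number of digits dropped.
\<close>

lemma zero_free_prefix:
  assumes "q > 1" "sloane q x \<noteq> 0" "x \<ge> q ^ j"
  shows "\<exists>w\<in>zero_free_words q j. \<exists>e. w * q ^ e \<le> x \<and> x < (w + 1) * q ^ e"
  using assms(2,3)
proof (induction x rule: less_induct)
  case (less x)
  show ?case
  proof (cases "x < q ^ Suc j")
    case True
    then show ?thesis
      using less.prems by (intro bexI[of _ x] exI[of _ 0]) (auto simp: zero_free_words_def)
  next
    case False
    have "q ^ Suc j \<ge> q" using assms by simp
    then have xq: "x \<ge> q" using False by linarith
    have "sloane q (x div q) \<noteq> 0"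
      using sloane_step[OF assms(1) xq] less.prems by auto
    moreover have "x div q < x" using assms xq by auto
    moreover have "x div q \<ge> q ^ j"
      using False assms by (simp add: less_eq_div_iff_mult_less_eq mult_ac)
    ultimately obtain w e where w: "w \<in> zero_free_words q j"
        "w * q ^ e \<le> x div q" "x div q < (w + 1) * q ^ e"
      using less.IH by blast
    have "w * q ^ e * q \<le> x"
      using w(2) assms by (subst less_eq_div_iff_mult_less_eq[symmetric]) auto
    moreover have "x < (w + 1) * q ^ e * q"
      using w(3) assms by (subst div_less_iff_less_mult[symmetric]) auto
    ultimately show ?thesis
      using w(1) by (intro bexI[of _ w] exI[of _ "Suc e"]) (auto simp: mult_ac)
  qed
qed

text \<open>
  For \<open>x\<close> starting with \<open>w\<close>, the number \<open>log q x\<close> lies modulo \<open>1\<close> in an arc of length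
  \<open>log q (1 + 1 / w) \<le> 1 / w\<close>; the last inequality is where \<open>ln q \<ge> 1\<close>, that is \<open>q \<ge> 3\<close>, enters.
\<close>

lemma same_prefix_log_close:
  fixes q w b C n n' e e' :: nat
  assumes q: "q \<ge> 3" and w: "w > 0" and b: "b > 0" and C: "C > 0"
    and x: "w * q ^ e \<le> b ^ n * C" "b ^ n * C < (w + 1) * q ^ e"
    and x': "w * q ^ e' \<le> b ^ n' * C" "b ^ n' * C < (w + 1) * q ^ e'"
  shows "\<bar>(real n - real n') * log (real q) (real b) - of_int (int e - int e')\<bar> < 1 / real w"
proof -
  have bounds: "log q w \<le> real a * log q b + log q C - real f \<and>
      real a * log q b + log q C - real f < log q (real w + 1)"
    if "w * q ^ f \<le> b ^ a * C" "b ^ a * C < (w + 1) * q ^ f" for a f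
  proof -
    have "real (w * q ^ f) \<le> real (b ^ a * C)"
      using that by (simp only: of_nat_le_iff)
    moreover have "real (b ^ a * C) < real ((w + 1) * q ^ f)"
      using that by (simp only: of_nat_less_iff)
    moreover have "real (w * q ^ f) > 0" "real (b ^ a * C) > 0" "real q > 1"
        "real ((w + 1) * q ^ f) > 0"
      using q w b C by (auto simp del: of_nat_mult of_nat_add of_nat_power)
    ultimately have "log q (w * q ^ f) \<le> log q (b ^ a * C)"
        "log q (b ^ a * C) < log q ((w + 1) * q ^ f)"
      by (simp_all only: log_le_cancel_iff log_less_cancel_iff)
    moreover have "log q (w * q ^ f) = log q w + real f"
        "log q ((w + 1) * q ^ f) = log q (real w + 1) + real f"
        "log q (b ^ a * C) = real a * log q b + log q C"
      using q w b C by (simp_all only: of_nat_mult of_nat_add of_nat_power of_nat_1)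
        (simp_all add: log_mult log_nat_power)
    ultimately show ?thesis by linarith
  qed
  have "ln (real q) \<ge> 1"
  proof -
    have "exp 1 \<le> real q" using exp_le q by linarith
    then show ?thesis using q by (simp add: ln_ge_iff)
  qed
  moreover have "ln (real w + 1) - ln w \<ge> 0"
    using w by simp
  ultimately have "(ln (real w + 1) - ln w) / ln q \<le> (ln (real w + 1) - ln w) / 1"
    by (intro divide_left_mono) auto
  then have "log q (real w + 1) - log q w \<le> ln (real w + 1) - ln w"
    by (simp add: log_def diff_divide_distrib)
  also have "\<dots> = ln (1 + 1 / w)"
    using w ln_divide_pos[of "real w + 1" "real w"] by (simp add: add_divide_distrib)
  also have "\<dots> \<le> 1 / w"
    by (intro ln_add_one_self_le_self) simp
  finally have "log q (real w + 1) - log q w \<le> 1 / w" .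
  moreover have "(real n - real n') * log q b - of_int (int e - int e')
      = (real n * log q b + log q C - real e) - (real n' * log q b + log q C - real e')"
    by (simp add: left_diff_distrib)
  ultimately show ?thesis
    using bounds[OF x] bounds[OF x'] by linarith
qed

section \<open>Rarity of zero-free terms in a geometric progression\<close>

text \<open>
  The union bound over the zero-free words of \<open>l + 2\<close> digits, each of them estimated by packing.
  The terms below \<open>q ^ (l + 1)\<close> are too short to have a leading word of \<open>l + 2\<close> digits. As
  \<open>b ^ n > n\<close>, there are at most \<open>q ^ (l + 1)\<close> of them; they contribute to \<open>T\<close>.
\<close>

lemma count_zero_free_powers:
  fixes q b l :: nat
  assumes q: "q \<ge> 3" and irr: "log (real q) (real b) \<notin> \<rat>"
  obtains T where
    "\<And>N C. C > 0 \<Longrightarrow> q ^ l * card {n. n \<le> N \<and> sloane q (b ^ n * C) \<noteq> 0}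
                        \<le> (q - 1) ^ (l + 2) * (N + 1) + T"
proof -
  have b: "b \<ge> 2"
  proof (rule ccontr)
    assume "\<not> b \<ge> 2"
    then have "b = 0 \<or> b = 1" by linarith
    then show False using irr by (auto simp: log_def)
  qed
  have "q ^ l > 0" using q by simp
  from packing_close_multiples[OF irr this] obtain S where S: "\<forall>N. \<forall>E\<subseteq>{..N}.
       (\<forall>n\<in>E. \<forall>n'\<in>E. \<exists>z::int.
          \<bar>(real n - real n') * log (real q) (real b) - of_int z\<bar> < 1 / (2 * real (q ^ l))) \<longrightarrow>
       q ^ l * card E \<le> N + 1 + S" ..
  define T where "T = (q - 1) ^ (l + 2) * S + q ^ l * q ^ (l + 1)"
  have bound: "q ^ l * card {n. n \<le> N \<and> sloane q (b ^ n * C) \<noteq> 0}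
        \<le> (q - 1) ^ (l + 2) * (N + 1) + T" if C: "C > 0" for N C
  proof -
    define W where "W = zero_free_words q (l + 1)"
    define E where "E w = {n. n \<le> N \<and> (\<exists>e. w * q ^ e \<le> b ^ n * C \<and> b ^ n * C < (w + 1) * q ^ e)}"
      for w
    have fin: "finite (E w)" for w unfolding E_def by simp
    have finW: "finite W" unfolding W_def by (rule finite_zero_free_words)
    have cardE: "q ^ l * card (E w) \<le> N + 1 + S" if "w \<in> W" for w
    proof (rule S[rule_format])
      show "E w \<subseteq> {..N}" by (auto simp: E_def)
      fix n n' assume "n \<in> E w" "n' \<in> E w"
      then obtain e e' where e: "w * q ^ e \<le> b ^ n * C" "b ^ n * C < (w + 1) * q ^ e"
          "w * q ^ e' \<le> b ^ n' * C" "b ^ n' * C < (w + 1) * q ^ e'"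
        unfolding E_def by blast
      \<comment> \<open>Two digits more than \<open>l\<close> make the arc of \<open>w\<close> shorter than the separation of the shifts.\<close>
      have "2 * q ^ l \<le> q ^ (l + 1)" using q by simp
      also have "\<dots> \<le> w" using that by (simp add: W_def zero_free_words_def)
      finally have wl: "2 * q ^ l \<le> w" .
      have pos: "q ^ l > 0" using q by simp
      then have "w > 0" using wl by linarith
      from same_prefix_log_close[OF q this _ C e] b
      have "\<bar>(real n - real n') * log (real q) (real b) - of_int (int e - int e')\<bar> < 1 / real w"
        by simp
      also have "\<dots> \<le> 1 / real (2 * q ^ l)"
        using wl pos by (intro frac_le) (auto simp del: of_nat_mult of_nat_power)
      finally show "\<exists>z::int. \<bar>(real n - real n') * log (real q) (real b) - of_int z\<bar>
          < 1 / (2 * real (q ^ l))"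
        by (intro exI[of _ "int e - int e'"]) simp
    qed
    have "{n. n \<le> N \<and> sloane q (b ^ n * C) \<noteq> 0} \<subseteq> {..<q ^ (l + 1)} \<union> (\<Union>w\<in>W. E w)"
    proof (intro subsetI UnCI)
      fix n assume "n \<in> {n. n \<le> N \<and> sloane q (b ^ n * C) \<noteq> 0}" and "n \<notin> (\<Union>w\<in>W. E w)"
      then have n: "n \<le> N" "sloane q (b ^ n * C) \<noteq> 0" "n \<notin> (\<Union>w\<in>W. E w)"
        by auto
      have "\<not> b ^ n * C \<ge> q ^ (l + 1)"
        using zero_free_prefix[OF _ n(2), of "l + 1"] n(1,3) q unfolding W_def E_def by auto
      moreover have "n < b ^ n" using b by (intro power_gt_expt) auto
      moreover have "b ^ n \<le> b ^ n * C" using C by simp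
      ultimately have "n < q ^ (l + 1)" by linarith
      then show "n \<in> {..<q ^ (l + 1)}" by simp
    qed
    then have "card {n. n \<le> N \<and> sloane q (b ^ n * C) \<noteq> 0}
        \<le> card ({..<q ^ (l + 1)} \<union> (\<Union>w\<in>W. E w))"
      by (intro card_mono) (auto simp: fin finW)
    also have "\<dots> \<le> q ^ (l + 1) + card (\<Union>w\<in>W. E w)"
      by (rule order_trans[OF card_Un_le]) simp
    also have "\<dots> \<le> q ^ (l + 1) + (\<Sum>w\<in>W. card (E w))"
      by (intro add_left_mono card_UN_le finW)
    finally have "q ^ l * card {n. n \<le> N \<and> sloane q (b ^ n * C) \<noteq> 0}
        \<le> q ^ l * (q ^ (l + 1) + (\<Sum>w\<in>W. card (E w)))"
      by (rule mult_left_mono) simp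
    also have "\<dots> = q ^ l * q ^ (l + 1) + (\<Sum>w\<in>W. q ^ l * card (E w))"
      by (simp add: distrib_left sum_distrib_left)
    also have "\<dots> \<le> q ^ l * q ^ (l + 1) + card W * (N + 1 + S)"
      using sum_bounded_above[of W "\<lambda>w. q ^ l * card (E w)" "N + 1 + S"] cardE by simp
    also have "\<dots> \<le> q ^ l * q ^ (l + 1) + (q - 1) ^ (l + 2) * (N + 1 + S)"
      using card_zero_free_words[of q "l + 1"] q
      by (intro add_left_mono mult_right_mono) (auto simp: W_def)
    also have "\<dots> = (q - 1) ^ (l + 2) * (N + 1) + T"
      by (simp only: T_def distrib_left add_ac)
    finally show ?thesis .
  qed
  show ?thesis by (rule that[OF bound])
qed

text \<open>
  After division by \<open>q ^ l\<close> the main term of \<open>count_zero_free_powers\<close> has a coefficient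
  \<open>(q - 1)\<^sup>2 * ((q - 1) / q) ^ l\<close>, below \<open>\<epsilon> / 2\<close> for some \<open>l\<close>. With this \<open>l\<close> fixed, \<open>T\<close> is a
  constant, and large \<open>N\<close> absorb it into the other \<open>\<epsilon> / 2\<close>.
\<close>

lemma zero_free_powers_rare:
  fixes q b :: nat and \<epsilon> :: real
  assumes q: "q \<ge> 3" and irr: "log (real q) (real b) \<notin> \<rat>" and \<epsilon>: "\<epsilon> > 0"
  obtains N\<^sub>0 where
    "\<And>N C. N \<ge> N\<^sub>0 \<Longrightarrow> C > 0 \<Longrightarrow>
       real (card {n. n \<le> N \<and> sloane q (b ^ n * C) \<noteq> 0}) \<le> \<epsilon> * (real N + 1)"
proof -
  have "(\<lambda>l. real (q - 1) ^ 2 * (real (q - 1) / real q) ^ l) \<longlonglongrightarrow> real (q - 1) ^ 2 * 0"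
    using q by (intro tendsto_mult_left LIMSEQ_power_zero) auto
  then have "\<forall>\<^sub>F l in sequentially. real (q - 1) ^ 2 * (real (q - 1) / real q) ^ l < \<epsilon> / 2"
    using \<epsilon> by (intro order_tendstoD(2)) auto
  then obtain l where l: "real (q - 1) ^ 2 * (real (q - 1) / real q) ^ l < \<epsilon> / 2"
    by (auto simp: eventually_sequentially)
  have Q: "real q ^ l > 0" using q by simp
  have l': "real (q - 1) ^ (l + 2) \<le> \<epsilon> / 2 * real q ^ l"
    using l Q by (simp add: power_divide power_add field_simps power2_eq_square)
  obtain T where T: "\<And>N C. C > 0 \<Longrightarrow>
      q ^ l * card {n. n \<le> N \<and> sloane q (b ^ n * C) \<noteq> 0} \<le> (q - 1) ^ (l + 2) * (N + 1) + T"
    using count_zero_free_powers[OF q irr] by blast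
  define N\<^sub>0 where "N\<^sub>0 = nat \<lceil>2 * real T / (\<epsilon> * real q ^ l)\<rceil>"
  have bound: "real (card {n. n \<le> N \<and> sloane q (b ^ n * C) \<noteq> 0}) \<le> \<epsilon> * (real N + 1)"
    if N: "N \<ge> N\<^sub>0" and C: "C > 0" for N C
  proof -
    let ?c = "card {n. n \<le> N \<and> sloane q (b ^ n * C) \<noteq> 0}"
    have "2 * real T / (\<epsilon> * real q ^ l) \<le> real N"
      using N unfolding N\<^sub>0_def by linarith
    then have "real T \<le> \<epsilon> / 2 * real q ^ l * real N"
      using \<epsilon> Q by (simp add: field_simps)
    also have "\<dots> \<le> \<epsilon> / 2 * real q ^ l * (real N + 1)"
      using \<epsilon> by (intro mult_left_mono) auto
    finally have T': "real T \<le> \<epsilon> / 2 * real q ^ l * (real N + 1)" .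
    have "real (q ^ l * ?c) \<le> real ((q - 1) ^ (l + 2) * (N + 1) + T)"
      using T[OF C] by (simp only: of_nat_le_iff)
    then have "real q ^ l * real ?c \<le> real (q - 1) ^ (l + 2) * (real N + 1) + real T"
      by (simp only: of_nat_add of_nat_mult of_nat_power of_nat_1)
    also have "\<dots> \<le> \<epsilon> / 2 * real q ^ l * (real N + 1) + \<epsilon> / 2 * real q ^ l * (real N + 1)"
      using T' l' by (intro add_mono mult_right_mono) auto
    also have "\<dots> = real q ^ l * (\<epsilon> * (real N + 1))"
      by (simp add: field_simps)
    finally show ?thesis using Q by simp
  qed
  show ?thesis by (rule that[OF bound])
qed

section \<open>Densities of sets of tuples\<close>

lemma tuple_box_eq_PiE: "tuple_box k N = {1..k} \<rightarrow>\<^sub>E {..N}"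
  by (auto simp: tuple_box_def nat_tuples_def PiE_def)

lemma card_tuple_box: "card (tuple_box k N) = (N + 1) ^ k"
  by (simp add: tuple_box_eq_PiE card_PiE)

text \<open>
  Fibre the box over the coordinates other than the first: if every line in direction \<open>1\<close> meets
  \<open>B\<close> in at most \<open>c\<close> points, summation over the \<open>(N + 1) ^ (k - 1)\<close> lines bounds \<open>B\<close>.
\<close>

lemma card_le_by_lines:
  fixes c :: real
  assumes k: "k \<ge> 1" and B: "B \<subseteq> tuple_box k N"
    and lines: "\<And>g. real (card {a. a \<le> N \<and> g(1 := a) \<in> B}) \<le> c"
  shows "real (card B) \<le> (real N + 1) ^ (k - 1) * c"
proof -
  define G where "G = {2..k} \<rightarrow>\<^sub>E {..N}"
  have finG: "finite G" unfolding G_def by (intro finite_PiE) auto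
  have cG: "card G = (N + 1) ^ (k - 1)"
    unfolding G_def by (simp add: card_PiE)
  have "B \<subseteq> (\<Union>g\<in>G. (\<lambda>a. g(1 := a)) ` {a. a \<le> N \<and> g(1 := a) \<in> B})"
  proof
    fix f assume f: "f \<in> B"
    then have fb: "f \<in> {1..k} \<rightarrow>\<^sub>E {..N}"
      using B tuple_box_eq_PiE by blast
    have "f(1 := undefined) \<in> G"
      using fb by (auto simp: G_def PiE_iff extensional_def)
    moreover have "f 1 \<le> N" using fb k by (auto simp: PiE_iff)
    ultimately show "f \<in> (\<Union>g\<in>G. (\<lambda>a. g(1 := a)) ` {a. a \<le> N \<and> g(1 := a) \<in> B})"
      using f by (intro UN_I[of "f(1 := undefined)"] image_eqI[of _ _ "f 1"]) auto
  qed
  then have "card B \<le> card (\<Union>g\<in>G. (\<lambda>a. g(1 := a)) ` {a. a \<le> N \<and> g(1 := a) \<in> B})"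
    using finG by (intro card_mono finite_UN_I finite_imageI) auto
  also have "\<dots> \<le> (\<Sum>g\<in>G. card ((\<lambda>a. g(1 := a)) ` {a. a \<le> N \<and> g(1 := a) \<in> B}))"
    by (rule card_UN_le[OF finG])
  also have "\<dots> \<le> (\<Sum>g\<in>G. card {a. a \<le> N \<and> g(1 := a) \<in> B})"
    by (intro sum_mono card_image_le) auto
  finally have "real (card B) \<le> (\<Sum>g\<in>G. real (card {a. a \<le> N \<and> g(1 := a) \<in> B}))"
    by (simp flip: of_nat_sum)
  also have "\<dots> \<le> real (card G) * c"
    using sum_bounded_above[of G "\<lambda>g. real (card {a. a \<le> N \<and> g(1 := a) \<in> B})" c] lines by simp
  finally show ?thesis by (simp add: cG add_ac)
qed

text \<open>
  The density is normalised by \<open>N ^ k\<close> whereas the box has \<open>(N + 1) ^ k\<close> elements; the quotient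
  of the two tends to \<open>1\<close>, so passing to the complement is harmless.
\<close>

lemma density_one_if_complement_rare:
  assumes rare: "\<And>\<epsilon>::real. \<epsilon> > 0 \<Longrightarrow>
      \<forall>\<^sub>F N in sequentially. real (card (tuple_box k N - A)) \<le> \<epsilon> * (real N + 1) ^ k"
  shows "has_asymptotic_density k A 1"
proof -
  define r where "r N = real (card (tuple_box k N - A)) / (real N + 1) ^ k" for N
  have "r \<longlonglongrightarrow> 0"
  proof (rule LIMSEQ_I)
    fix \<epsilon> :: real assume "\<epsilon> > 0"
    then obtain N\<^sub>0 where N\<^sub>0: "\<And>N. N \<ge> N\<^sub>0 \<Longrightarrow>
        real (card (tuple_box k N - A)) \<le> \<epsilon> / 2 * (real N + 1) ^ k"
      using rare[of "\<epsilon> / 2"] by (auto simp: eventually_sequentially)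
    have "r N \<le> \<epsilon> / 2" if "N \<ge> N\<^sub>0" for N
      using N\<^sub>0[OF that] unfolding r_def by (simp add: pos_divide_le_eq)
    moreover have "r N \<ge> 0" for N unfolding r_def by simp
    ultimately show "\<exists>no. \<forall>n\<ge>no. norm (r n - 0) < \<epsilon>"
      using \<open>\<epsilon> > 0\<close> by (intro exI[of _ N\<^sub>0]) (smt (verit) field_sum_of_halves real_norm_def)
  qed
  moreover have "(\<lambda>N. ((real N + 1) / real N) ^ k) \<longlonglongrightarrow> 1 ^ k"
    by (intro tendsto_power) real_asymp
  ultimately have "(\<lambda>N. ((real N + 1) / real N) ^ k * (1 - r N)) \<longlonglongrightarrow> 1 ^ k * (1 - 0)"
    by (intro tendsto_mult tendsto_diff tendsto_const)
  moreover have "((real N + 1) / real N) ^ k * (1 - r N)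
      = real (card (A \<inter> tuple_box k N)) / real N ^ k" for N
  proof -
    have "card (tuple_box k N) = card (A \<inter> tuple_box k N) + card (tuple_box k N - A)"
      using card_Int_Diff[OF finite_tuple_box, of k N A] by (simp add: Int_commute)
    then have "(real N + 1) ^ k
        = real (card (A \<inter> tuple_box k N)) + real (card (tuple_box k N - A))"
      unfolding card_tuple_box by (metis of_nat_1 of_nat_add of_nat_power)
    moreover have pos: "(real N + 1) ^ k > 0" by simp
    moreover have "1 - r N
        = ((real N + 1) ^ k - real (card (tuple_box k N - A))) / (real N + 1) ^ k"
      using pos unfolding r_def by (simp add: diff_divide_distrib)
    ultimately show ?thesis
      by (simp add: power_divide)
  qed
  ultimately have "(\<lambda>N. real (card (A \<inter> tuple_box k N)) / real N ^ k) \<longlonglongrightarrow> 1"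
    by simp
  then have lim: "(\<lambda>N. ereal (real (card (A \<inter> tuple_box k N)) / real N ^ k)) \<longlonglongrightarrow> ereal 1"
    by simp
  then show ?thesis
    unfolding has_asymptotic_density_def lower_density_def upper_density_def
    using lim_imp_Liminf[OF _ lim] lim_imp_Limsup[OF _ lim] by simp
qed

text \<open>
  A rational \<open>x\<close> is a rational multiple of the entry \<open>1\<close>, which differs from \<open>x\<close> because the
  entries are distinct.
\<close>

lemma irrational_if_rationally_independent:
  assumes "rationally_independent (1 # xs)" "x \<in> set xs"
  shows "x \<notin> \<rat>"
proof
  assume "x \<in> \<rat>"
  then obtain r where x: "x = of_rat r" by (auto elim: Rats_cases)
  have "x \<noteq> 1" using assms by (auto simp: rationally_independent_def)
  then have "1 \<in> set (1 # xs) - {x}" by auto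
  then have "of_rat r * 1 \<in> rat_real.span (set (1 # xs) - {x})"
    by (intro rat_real.span_scale rat_real.span_base)
  then show False
    using assms x unfolding rationally_independent_def rat_real.dependent_def by auto
qed

section \<open>Density one\<close>

theorem theorem2:
  fixes q m k d :: nat and p i :: "nat \<Rightarrow> nat" and \<alpha> :: "nat \<Rightarrow> real"
  assumes "q \<ge> 3"
    and "strict_mono_on {1..m} p"
    and "p ` {1..m} = {r. prime r \<and> r < q}"
    and "\<And>j. j \<in> {1..m} \<Longrightarrow> \<alpha> j = log (real q) (real (p j))"
    and "k \<ge> 1"
    and "strict_mono_on {1..k} i"
    and "i ` {1..k} \<subseteq> {1..m}"
    and "rationally_independent (1 # map (\<lambda>j. \<alpha> (i j)) [1..<Suc k])"
    and "d > 0"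
    and "d dvd q"
  shows "has_asymptotic_density k
           {n \<in> nat_tuples k. sloane q ((\<Prod>j\<in>{1..k}. p (i j) ^ n j) * d) = 0} 1"
    (is "has_asymptotic_density k ?A 1")
proof (rule density_one_if_complement_rare)
  fix \<epsilon> :: real assume \<epsilon>: "\<epsilon> > 0"
  define b where "b = p (i 1)"
  have i1: "i 1 \<in> {1..m}"
    using assms(5) by (intro subsetD[OF assms(7)] imageI) simp
  have "1 \<in> set [1..<Suc k]"
    using assms(5) by (simp only: set_upt atLeastLessThan_iff less_Suc_eq_le le_refl)
  then have "\<alpha> (i 1) \<in> set (map (\<lambda>j. \<alpha> (i j)) [1..<Suc k])"
    unfolding set_map by (rule imageI)
  then have "\<alpha> (i 1) \<notin> \<rat>"
    using irrational_if_rationally_independent[OF assms(8)] by blast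
  then have irr: "log (real q) (real b) \<notin> \<rat>"
    using assms(4)[OF i1] by (simp add: b_def)
  obtain N\<^sub>0 where N\<^sub>0: "\<And>N C. N \<ge> N\<^sub>0 \<Longrightarrow> C > 0 \<Longrightarrow>
       real (card {n. n \<le> N \<and> sloane q (b ^ n * C) \<noteq> 0}) \<le> \<epsilon> * (real N + 1)"
    using zero_free_powers_rare[OF assms(1) irr \<epsilon>] by blast
  have ppos: "p (i j) > 0" if "j \<in> {1..k}" for j
  proof -
    have "p (i j) \<in> {r. prime r \<and> r < q}"
      using assms(3,7) that by blast
    then show ?thesis by (auto intro: prime_gt_0_nat)
  qed
  have "real (card (tuple_box k N - ?A)) \<le> \<epsilon> * (real N + 1) ^ k" if N: "N \<ge> N\<^sub>0" for N
  proof -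
    have "real (card (tuple_box k N - ?A)) \<le> (real N + 1) ^ (k - 1) * (\<epsilon> * (real N + 1))"
    proof (rule card_le_by_lines[OF assms(5)])
      fix g :: "nat \<Rightarrow> nat"
      define C where "C = (\<Prod>j\<in>{2..k}. p (i j) ^ g j) * d"
      have "C > 0" unfolding C_def using ppos assms(9) by (auto intro!: prod_pos)
      have split: "{1..k} = insert 1 {2..k}" using assms(5) by auto
      have "(\<Prod>j\<in>{1..k}. p (i j) ^ (g(1 := a)) j) * d = b ^ a * C" for a
        unfolding split b_def C_def by (simp add: mult_ac)
      then have "{a. a \<le> N \<and> g(1 := a) \<in> tuple_box k N - ?A}
          \<subseteq> {n. n \<le> N \<and> sloane q (b ^ n * C) \<noteq> 0}"
        by (auto simp: tuple_box_def)
      then have "card {a. a \<le> N \<and> g(1 := a) \<in> tuple_box k N - ?A}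
          \<le> card {n. n \<le> N \<and> sloane q (b ^ n * C) \<noteq> 0}"
        by (intro card_mono) auto
      then show "real (card {a. a \<le> N \<and> g(1 := a) \<in> tuple_box k N - ?A}) \<le> \<epsilon> * (real N + 1)"
        using N\<^sub>0[OF N \<open>C > 0\<close>] by linarith
    qed auto
    also have "\<dots> = \<epsilon> * (real N + 1) ^ k"
      using assms(5) by (cases k) auto
    finally show ?thesis .
  qed
  then show "\<forall>\<^sub>F N in sequentially. real (card (tuple_box k N - ?A)) \<le> \<epsilon> * (real N + 1) ^ k"
    by (auto simp: eventually_sequentially)
qed

end
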